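(* Let $G$ and $H$ be graphs that have no isolated vertices, let $d\ge 2$ be an integer, and let $n_1,\ldots,n_d$ be positive integers. Then $$\iota(G\times H, K_{n_1,\ldots,n_d})\le \min\big\{\iota(G,K_d)\,\gamma_t(H),\ \iota(H,K_d)\,\gamma_t(G)\big\}.$$
   Context: All graphs are finite, simple and undirected. $K_{n_1,\ldots,n_d}$ is the complete $d$-partite graph with parts of sizes $n_1,\ldots,n_d$, and $K_d$ is the complete graph on $d$ vertices. The direct product $G\times H$ has vertex set $V(G)\times V(H)$, and $(g,h)$, $(g',h')$ are adjacent if and only if $gg'\in E(G)$ and $hh'\in E(H)$. $N_G[S]$ is the closed neighborhood of $S\subseteq V(G)$, i.e. $S$ together with all vertices having a neighbor in $S$. For a graph $F$, a set $S\subseteq V(G)$ is an $F$-isolating set of $G$ if the subgraph induced by $V(G)-N_G[S]$ contains no (not necessarily induced) subgraph isomorphic to $F$; $\iota(G,F)$ is the minimum cardinality of an $F$-isolating set of $G$. A total dominating set of $G$ is a set $D\subseteq V(G)$ such that every vertex of $G$ has a neighbor in $D$; $\gamma_t(G)$ is the minimum cardinality of such a set. *)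

theory Defs
  imports "Graph_Theory.Graph_Theory"
begin

text \<open>
  Finite simple undirected graphs are rendered as the locale \<^locale>\<open>pair_graph\<close>: finite,
  loop-free, symmetric sets of arcs, where an edge $uv$ stands for the two arcs $(u,v)$ and $(v,u)$.
\<close>

definition no_isolated_vertices :: "'a pair_pre_digraph \<Rightarrow> bool" where
  "no_isolated_vertices G \<longleftrightarrow> (\<forall>v \<in> pverts G. \<exists>w. (v, w) \<in> parcs G)"

definition direct_product ::
    "'a pair_pre_digraph \<Rightarrow> 'b pair_pre_digraph \<Rightarrow> ('a \<times> 'b) pair_pre_digraph" where
  "direct_product G H =
    \<lparr> pverts = pverts G \<times> pverts H,
      parcs = {((g, h), (g', h')) | g h g' h'. (g, g') \<in> parcs G \<and> (h, h') \<in> parcs H} \<rparr>"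

text \<open>\<^const>\<open>complete_digraph\<close> characterises complete graphs up to isomorphism; this is a
  concrete representative (see \<open>complete_digraph_complete_graph\<close> below).\<close>

definition complete_graph :: "nat \<Rightarrow> nat pair_pre_digraph" where
  "complete_graph d =
    \<lparr> pverts = {1..d}, parcs = {(u, v). u \<in> {1..d} \<and> v \<in> {1..d} \<and> u \<noteq> v} \<rparr>"

text \<open>The vertex $(i,j)$ is the $j$-th element of the $i$-th part, which has size \<open>n i\<close>.\<close>

definition complete_multipartite_graph :: "nat \<Rightarrow> (nat \<Rightarrow> nat) \<Rightarrow> (nat \<times> nat) pair_pre_digraph" where
  "complete_multipartite_graph d n =
    (let V = (SIGMA i:{1..d}. {1..n i})
     in \<lparr> pverts = V, parcs = {(u, v). u \<in> V \<and> v \<in> V \<and> fst u \<noteq> fst v} \<rparr>)"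

definition closed_neighborhood :: "'a pair_pre_digraph \<Rightarrow> 'a set \<Rightarrow> 'a set" where
  "closed_neighborhood G S = S \<union> {v \<in> pverts G. \<exists>s \<in> S. (v, s) \<in> parcs G}"

definition contains_copy :: "('a, 'b) pre_digraph \<Rightarrow> ('c, 'd) pre_digraph \<Rightarrow> bool" where
  "contains_copy G F \<longleftrightarrow> (\<exists>C. subgraph C G \<and> digraph_iso F C)"

definition isolating_set :: "'a pair_pre_digraph \<Rightarrow> 'c pair_pre_digraph \<Rightarrow> 'a set \<Rightarrow> bool" where
  "isolating_set G F S \<longleftrightarrow> S \<subseteq> pverts G \<and>
    \<not> contains_copy (with_proj G \<restriction> (pverts G - closed_neighborhood G S)) (with_proj F)"

definition isolation_number :: "'a pair_pre_digraph \<Rightarrow> 'c pair_pre_digraph \<Rightarrow> nat" where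
  "isolation_number G F = (LEAST k. \<exists>S. isolating_set G F S \<and> card S = k)"

definition total_dominating_set :: "'a pair_pre_digraph \<Rightarrow> 'a set \<Rightarrow> bool" where
  "total_dominating_set G D \<longleftrightarrow> D \<subseteq> pverts G \<and> (\<forall>v \<in> pverts G. \<exists>u \<in> D. (v, u) \<in> parcs G)"

definition total_domination_number :: "'a pair_pre_digraph \<Rightarrow> nat" where
  "total_domination_number G = (LEAST k. \<exists>D. total_dominating_set G D \<and> card D = k)"

text \<open>Well-formedness of the constructions, and agreement with the library's notions.\<close>

lemma pair_graphI_simple:
  assumes "finite (pverts G)" "parcs G \<subseteq> pverts G \<times> pverts G" "irrefl (parcs G)" "sym (parcs G)"
  shows "pair_graph G"
proof -
  have "finite (parcs G)"
    using assms(1,2) finite_subset by blast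
  then show ?thesis
    using assms by unfold_locales (auto simp: symmetric_def irrefl_def)
qed

lemma pair_graph_direct_product:
  assumes "pair_graph G" "pair_graph H"
  shows "pair_graph (direct_product G H)"
proof -
  interpret G: pair_graph G by fact
  interpret H: pair_graph H by fact
  have "sym (parcs G)" "sym (parcs H)"
    using G.pair_sym_arcs H.pair_sym_arcs by (simp_all add: symmetric_def)
  then have "sym (parcs (direct_product G H))"
    by (auto simp: direct_product_def sym_def)
  moreover have "irrefl (parcs (direct_product G H))"
    by (auto simp: direct_product_def irrefl_def dest: G.pair_no_loops)
  moreover have "parcs (direct_product G H) \<subseteq>
      pverts (direct_product G H) \<times> pverts (direct_product G H)"
    by (auto simp: direct_product_def dest: G.wellformed' H.wellformed')
  moreover have "finite (pverts (direct_product G H))"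
    by (simp add: direct_product_def)
  ultimately show ?thesis
    by (intro pair_graphI_simple)
qed

lemma complete_digraph_complete_graph: "complete_digraph d (with_proj (complete_graph d))"
  by (auto simp: complete_digraph_pair_def complete_graph_def)

lemma pair_graph_complete_multipartite_graph: "pair_graph (complete_multipartite_graph d n)"
  by (rule pair_graphI_simple)
    (auto simp: complete_multipartite_graph_def Let_def irrefl_def sym_def)

lemma complete_bipartite_digraph_complete_multipartite_graph:
  "complete_bipartite_digraph (n 1) (n 2) (with_proj (complete_multipartite_graph 2 n))"
proof -
  let ?U = "{1::nat} \<times> {1..n 1}" and ?V = "{2::nat} \<times> {1..n 2}"
  have V: "(SIGMA i:{1..2}. {1..n i}) = ?U \<union> ?V"
    by (auto simp: atLeastAtMost_iff le_Suc_eq numeral_2_eq_2)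
  have "pverts (complete_multipartite_graph 2 n) = ?U \<union> ?V"
    by (simp only: complete_multipartite_graph_def Let_def pair_pre_digraph.simps V)
  moreover have "parcs (complete_multipartite_graph 2 n) = ?U \<times> ?V \<union> ?V \<times> ?U"
    unfolding complete_multipartite_graph_def Let_def pair_pre_digraph.simps V by auto
  moreover have "?U \<inter> ?V = {}" "card ?U = n 1" "card ?V = n 2"
    by (auto simp: card_cartesian_product)
  ultimately show ?thesis
    unfolding complete_bipartite_digraph_pair_def
    by (intro conjI exI[of _ ?U] exI[of _ ?V]) simp_all
qed

text \<open>The two minima are over nonempty collections in the cases of interest.\<close>

lemma isolating_set_pverts:
  assumes "pverts F \<noteq> {}"
  shows "isolating_set G F (pverts G)"
proof -
  have *: "pverts G - closed_neighborhood G (pverts G) = {}"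
    by (auto simp: closed_neighborhood_def)
  show ?thesis
    unfolding isolating_set_def *
    using assms by (auto simp: contains_copy_def subgraph_def digraph_iso_def verts_app_iso)
qed

lemma total_dominating_set_pverts:
  assumes "pair_graph G" "no_isolated_vertices G"
  shows "total_dominating_set G (pverts G)"
proof -
  interpret pair_graph G by fact
  show ?thesis
    using assms(2) by (auto simp: total_dominating_set_def no_isolated_vertices_def
        dest: wellformed')
qed

end

theory Submission
  imports Defs
begin

text \<open>
  Let \<open>S\<close> be a minimum \<open>K\<^sub>d\<close>-isolating set of \<open>G\<close> and \<open>D\<close> a minimum total dominating set of \<open>H\<close>.
  The set \<open>S \<times> D\<close> isolates every complete \<open>d\<close>-partite graph in \<open>G \<times> H\<close>. The key point is that any
  vertex \<open>(g, h)\<close> with \<open>g\<close> adjacent to some \<open>s \<in> S\<close> is dominated: \<open>h\<close> has a neighbour \<open>u \<in> D\<close>, and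
  \<open>(s, u)\<close> is then a neighbour of \<open>(g, h)\<close>.

  Suppose that a copy of \<open>K\<^bsub>n\<^sub>1,\<dots>,n\<^sub>d\<^esub>\<close> survives outside the closed neighbourhood of \<open>S \<times> D\<close>. One vertex
  from each part gives \<open>d\<close> pairwise adjacent vertices of \<open>G \<times> H\<close>, and their first coordinates
  \<open>g\<^sub>1, \<dots>, g\<^sub>d\<close> are pairwise adjacent, so they form a \<open>K\<^sub>d\<close> in \<open>G\<close>. By the key point no \<open>g\<^sub>i\<close> has a
  neighbour in \<open>S\<close>. Nor is any \<open>g\<^sub>i\<close> itself in \<open>S\<close>: as \<open>d \<ge> 2\<close> there is another \<open>g\<^sub>j\<close>, which would
  have the neighbour \<open>g\<^sub>i\<close> in \<open>S\<close>. So this \<open>K\<^sub>d\<close> avoids the closed neighbourhood of \<open>S\<close>, which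
  contradicts the choice of \<open>S\<close>.

  Only two facts about the projection to \<open>G\<close> enter: it is a graph homomorphism, and the key point.
  Lemma \<open>isolating_set_lift\<close> is therefore stated for an arbitrary homomorphism, and the two bounds
  of the minimum come from it through the two projections of the product.
\<close>

text \<open>
  A copy is by definition a subgraph together with an isomorphism that also acts on arcs.
  Since the arcs here are pairs of vertices, the vertex map determines everything, and a copy is the
  same as an injective homomorphism.
\<close>

lemma contains_copy_induced_iff:
  fixes G :: "'a pair_pre_digraph" and F :: "'c pair_pre_digraph"
  assumes "pair_wf_digraph F"
  shows "contains_copy (with_proj G \<restriction> A) (with_proj F) \<longleftrightarrow>
    (\<exists>f. inj_on f (pverts F) \<and> f ` pverts F \<subseteq> A \<and> (\<forall>u v. (u, v) \<in> parcs F \<longrightarrow> (f u, f v) \<in> parcs G))"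
    (is "?copy \<longleftrightarrow> ?embedding")
proof
  assume ?copy
  then obtain h where iso: "pre_digraph.digraph_isomorphism (with_proj F) h"
    and sub: "subgraph (app_iso h (with_proj F)) (with_proj G \<restriction> A)"
    by (auto simp: contains_copy_def digraph_iso_def)
  from sub have h: "iso_verts h ` pverts F \<subseteq> A" "iso_arcs h ` parcs F \<subseteq> parcs G"
      "iso_tail h = fst" "iso_head h = snd"
    by (auto simp: subgraph_def compatible_def)
  have "(iso_verts h u, iso_verts h v) \<in> parcs G" if "(u, v) \<in> parcs F" for u v
  proof -
    have "iso_arcs h (u, v) = (iso_verts h u, iso_verts h v)"
      using iso that h(3,4) by (fastforce simp: pre_digraph.digraph_isomorphism_def prod_eq_iff)
    then show ?thesis
      using h(2) that by force
  qed
  then show ?embedding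
    using iso h(1) by (auto simp: pre_digraph.digraph_isomorphism_def intro!: exI[of _ "iso_verts h"])
next
  assume ?embedding
  then obtain f where f: "inj_on f (pverts F)" "f ` pverts F \<subseteq> A"
    and arcs: "\<And>u v. (u, v) \<in> parcs F \<Longrightarrow> (f u, f v) \<in> parcs G"
    by auto
  interpret F: pair_wf_digraph F by fact
  define h where
    "h = \<lparr>iso_verts = f, iso_arcs = map_prod f f, iso_head = snd, iso_tail = fst\<rparr>"
  have "inj_on (map_prod f f) (parcs F)"
    using map_prod_inj_on[OF f(1) f(1)] by (rule inj_on_subset) (auto dest: F.in_arcsD1 F.in_arcsD2)
  then have iso: "F.digraph_isomorphism h"
    using f(1) by (simp add: F.digraph_isomorphism_def h_def F.wf_digraph)
  then have "wf_digraph (app_iso h (with_proj F))"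
    by (rule F.wf_digraphI_app_iso)
  moreover have "wf_digraph (with_proj G \<restriction> A)"
    by unfold_locales auto
  moreover have "(f u, f v) \<in> parcs G \<and> f u \<in> A \<and> f v \<in> A" if "(u, v) \<in> parcs F" for u v
    using that f(2) arcs by (blast dest: F.in_arcsD1 F.in_arcsD2)
  ultimately have "subgraph (app_iso h (with_proj F)) (with_proj G \<restriction> A)"
    using f(2) by (auto simp: subgraph_def compatible_def h_def)
  then show ?copy
    using iso by (auto simp: contains_copy_def digraph_iso_def)
qed

lemma pair_wf_digraph_complete_graph: "pair_wf_digraph (complete_graph d)"
  by unfold_locales (auto simp: complete_graph_def)

lemma contains_complete_graph_iff:
  assumes "pair_graph G"
  shows "contains_copy (with_proj G \<restriction> A) (with_proj (complete_graph d)) \<longleftrightarrow>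
    (\<exists>g. (\<forall>i \<in> {1..d}. g i \<in> A) \<and>
      (\<forall>i \<in> {1..d}. \<forall>j \<in> {1..d}. i \<noteq> j \<longrightarrow> (g i, g j) \<in> parcs G))"
proof -
  interpret pair_graph G by fact
  have "inj_on g {1..d}"
    if "\<forall>i \<in> {1..d}. \<forall>j \<in> {1..d}. i \<noteq> j \<longrightarrow> (g i, g j) \<in> parcs G" for g
    using that by (metis inj_onI pair_no_loops prod.sel)
  then show ?thesis
    unfolding contains_copy_induced_iff[OF pair_wf_digraph_complete_graph]
    by (intro ex_cong1) (auto simp: complete_graph_def image_subset_iff)
qed

lemma contains_complete_multipartite_graphD:
  assumes "contains_copy (with_proj G \<restriction> A) (with_proj (complete_multipartite_graph d n))"
    and "\<And>i. i \<in> {1..d} \<Longrightarrow> n i > 0"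
  obtains x where "\<And>i. i \<in> {1..d} \<Longrightarrow> x i \<in> A"
    and "\<And>i j. \<lbrakk>i \<in> {1..d}; j \<in> {1..d}; i \<noteq> j\<rbrakk> \<Longrightarrow> (x i, x j) \<in> parcs G"
proof -
  interpret F: pair_graph "complete_multipartite_graph d n"
    by (rule pair_graph_complete_multipartite_graph)
  obtain f where "f ` (SIGMA i:{1..d}. {1..n i}) \<subseteq> A"
    and "\<And>u v. \<lbrakk>u \<in> (SIGMA i:{1..d}. {1..n i}); v \<in> (SIGMA i:{1..d}. {1..n i}); fst u \<noteq> fst v\<rbrakk>
      \<Longrightarrow> (f u, f v) \<in> parcs G"
    using assms(1) unfolding contains_copy_induced_iff[OF F.pair_wf_digraph]
    by (auto simp: complete_multipartite_graph_def Let_def)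
  moreover have "(i, 1) \<in> (SIGMA i:{1..d}. {1..n i})" if "i \<in> {1..d}" for i
    using that assms(2)[of i] by auto
  ultimately show ?thesis
    by (intro that[of "\<lambda>i. f (i, 1)"]) (blast, simp)
qed

text \<open>
  A homomorphism sends a transversal of the multipartite copy to a clique. The lifting hypothesis
  keeps that clique away from the neighbours of \<open>S\<close>. It says nothing about vertices over \<open>S\<close> itself,
  but in a clique with at least two vertices a member of \<open>S\<close> would be a neighbour of the other
  vertices.
\<close>

lemma isolating_set_lift:
  fixes P :: "'p pair_pre_digraph" and G :: "'a pair_pre_digraph"
  assumes "pair_graph G" and "isolating_set G (complete_graph d) S"
    and "d \<ge> 2" and "\<And>i. i \<in> {1..d} \<Longrightarrow> n i > 0"
    and hom: "\<And>u v. (u, v) \<in> parcs P \<Longrightarrow> (p u, p v) \<in> parcs G"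
    and "T \<subseteq> pverts P"
    and lift: "\<And>v s. \<lbrakk>v \<in> pverts P; s \<in> S; (p v, s) \<in> parcs G\<rbrakk> \<Longrightarrow> \<exists>t \<in> T. (v, t) \<in> parcs P"
  shows "isolating_set P (complete_multipartite_graph d n) T"
  unfolding isolating_set_def
proof (intro conjI notI)
  interpret G: pair_graph G by fact
  let ?R = "pverts P - closed_neighborhood P T"
  let ?Q = "pverts G - closed_neighborhood G S"
  assume "contains_copy (with_proj P \<restriction> ?R) (with_proj (complete_multipartite_graph d n))"
  then obtain x where x: "\<And>i. i \<in> {1..d} \<Longrightarrow> x i \<in> ?R"
    and clique: "\<And>i j. \<lbrakk>i \<in> {1..d}; j \<in> {1..d}; i \<noteq> j\<rbrakk> \<Longrightarrow> (x i, x j) \<in> parcs P"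
    by (rule contains_complete_multipartite_graphD) (use assms(4) in auto)
  have no_neighbour: "(p (x i), s) \<notin> parcs G" if "i \<in> {1..d}" "s \<in> S" for i s
    using x[OF that(1)] lift[of "x i" s] that(2) by (auto simp: closed_neighborhood_def)
  have "p (x i) \<in> ?Q" if i: "i \<in> {1..d}" for i
  proof -
    define j where "j = (if i = 1 then 2 else 1 :: nat)"
    have j: "j \<in> {1..d}" "j \<noteq> i"
      using \<open>d \<ge> 2\<close> by (auto simp: j_def)
    then have "(p (x j), p (x i)) \<in> parcs G"
      using i by (intro hom clique)
    then have "p (x i) \<in> pverts G" "p (x i) \<notin> S"
      using no_neighbour[OF j(1)] by (auto dest: G.in_arcsD2)
    then show ?thesis
      using no_neighbour[OF i] by (auto simp: closed_neighborhood_def)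
  qed
  then have "contains_copy (with_proj G \<restriction> ?Q) (with_proj (complete_graph d))"
    unfolding contains_complete_graph_iff[OF \<open>pair_graph G\<close>]
    by (intro exI[of _ "\<lambda>i. p (x i)"]) (auto intro!: hom clique)
  then show False
    using assms(2) by (simp add: isolating_set_def)
qed fact

lemma isolation_number_le: "isolating_set G F S \<Longrightarrow> isolation_number G F \<le> card S"
  unfolding isolation_number_def by (rule Least_le) blast

lemma isolation_number_attained:
  assumes "pverts F \<noteq> {}"
  obtains S where "isolating_set G F S" "card S = isolation_number G F"
proof -
  have "\<exists>k S. isolating_set G F S \<and> card S = k"
    using isolating_set_pverts[OF assms, of G] by blast
  then have "\<exists>S. isolating_set G F S \<and> card S = isolation_number G F"
    unfolding isolation_number_def by (rule LeastI_ex)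
  then show ?thesis
    using that by blast
qed

lemma total_domination_number_attained:
  assumes "pair_graph G" "no_isolated_vertices G"
  obtains D where "total_dominating_set G D" "card D = total_domination_number G"
proof -
  have "\<exists>k D. total_dominating_set G D \<and> card D = k"
    using total_dominating_set_pverts[OF assms] by blast
  then have "\<exists>D. total_dominating_set G D \<and> card D = total_domination_number G"
    unfolding total_domination_number_def by (rule LeastI_ex)
  then show ?thesis
    using that by blast
qed

theorem theorem3p2:
  fixes G :: "'a pair_pre_digraph" and H :: "'b pair_pre_digraph"
    and d :: nat and n :: "nat \<Rightarrow> nat"
  assumes "pair_graph G" and "pair_graph H"
    and "no_isolated_vertices G" and "no_isolated_vertices H"
    and "d \<ge> 2" and "\<And>i. i \<in> {1..d} \<Longrightarrow> n i > 0"
  shows "isolation_number (direct_product G H) (complete_multipartite_graph d n)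
    \<le> min (isolation_number G (complete_graph d) * total_domination_number H)
          (isolation_number H (complete_graph d) * total_domination_number G)"
proof -
  let ?P = "direct_product G H" and ?K = "complete_multipartite_graph d n"
  have nonempty: "pverts (complete_graph d) \<noteq> {}"
    using \<open>d \<ge> 2\<close> by (simp add: complete_graph_def)
  have "isolation_number ?P ?K \<le> isolation_number G (complete_graph d) * total_domination_number H"
  proof -
    obtain S where S: "isolating_set G (complete_graph d) S"
        "card S = isolation_number G (complete_graph d)"
      using isolation_number_attained[OF nonempty] .
    obtain D where D: "total_dominating_set H D" "card D = total_domination_number H"
      using total_domination_number_attained[OF assms(2,4)] .
    have "isolating_set ?P ?K (S \<times> D)"
    proof (rule isolating_set_lift[where p = fst, OF assms(1) S(1) assms(5,6)])
      show "S \<times> D \<subseteq> pverts ?P"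
        using S(1) D(1) by (auto simp: direct_product_def isolating_set_def total_dominating_set_def)
      show "\<exists>t \<in> S \<times> D. (v, t) \<in> parcs ?P"
        if "v \<in> pverts ?P" "s \<in> S" "(fst v, s) \<in> parcs G" for v s
        using that D(1) by (fastforce simp: direct_product_def total_dominating_set_def)
    qed (auto simp: direct_product_def)
    then show ?thesis
      using isolation_number_le S(2) D(2) by (metis card_cartesian_product)
  qed
  moreover
  have "isolation_number ?P ?K \<le> isolation_number H (complete_graph d) * total_domination_number G"
  proof -
    obtain S where S: "isolating_set H (complete_graph d) S"
        "card S = isolation_number H (complete_graph d)"
      using isolation_number_attained[OF nonempty] .
    obtain D where D: "total_dominating_set G D" "card D = total_domination_number G"
      using total_domination_number_attained[OF assms(1,3)] .
    have "isolating_set ?P ?K (D \<times> S)"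
    proof (rule isolating_set_lift[where p = snd, OF assms(2) S(1) assms(5,6)])
      show "D \<times> S \<subseteq> pverts ?P"
        using S(1) D(1) by (auto simp: direct_product_def isolating_set_def total_dominating_set_def)
      show "\<exists>t \<in> D \<times> S. (v, t) \<in> parcs ?P"
        if "v \<in> pverts ?P" "s \<in> S" "(snd v, s) \<in> parcs H" for v s
        using that D(1) by (fastforce simp: direct_product_def total_dominating_set_def)
    qed (auto simp: direct_product_def)
    then show ?thesis
      using isolation_number_le S(2) D(2) by (metis card_cartesian_product mult.commute)
  qed
  ultimately show ?thesis
    by simp
qed

end
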